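(* Let $p$ be a prime number, let $P$ be a finite $p$-group and let $H$ be a finite group. Let $G=P\rtimes H$ be an associated semidirect product. If $C_G(P)\subseteq P$, then every Coleman automorphism of $G$ is inner.
   Context: An automorphism $\sigma$ of a finite group $G$ is a Coleman automorphism if for any prime $\ell$ dividing $|G|$ and any Sylow $\ell$-subgroup $Q$ of $G$ there exists $g\in G$ such that $\sigma|_Q=\mathrm{conj}(g)|_Q$, where $\mathrm{conj}(g)$ is the map $x\mapsto g^{-1}xg$. *)

theory Defs
  imports "HOL-Algebra.Bij" "HOL-Algebra.Sylow"
begin

definition finite_p_group :: "nat \<Rightarrow> ('a, 'c) monoid_scheme \<Rightarrow> bool"
  where "finite_p_group p P \<longleftrightarrow> group P \<and> finite (carrier P) \<and> (\<exists>n. order P = p ^ n)"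

definition sylow_subgroup :: "nat \<Rightarrow> 'a set \<Rightarrow> ('a, 'c) monoid_scheme \<Rightarrow> bool"
  where "sylow_subgroup l Q G \<longleftrightarrow> subgroup Q G \<and> card Q = l ^ multiplicity l (order G)"

definition centralizer :: "('a, 'c) monoid_scheme \<Rightarrow> 'a set \<Rightarrow> 'a set"
  where "centralizer G S = {g \<in> carrier G. \<forall>s\<in>S. g \<otimes>\<^bsub>G\<^esub> s = s \<otimes>\<^bsub>G\<^esub> g}"

text \<open>Conjugation is on the right, and restricted to the carrier because \<^const>\<open>auto\<close>
  consists of extensional functions.\<close>

definition conj_map :: "('a, 'c) monoid_scheme \<Rightarrow> 'a \<Rightarrow> 'a \<Rightarrow> 'a"
  where "conj_map G g = (\<lambda>x\<in>carrier G. inv\<^bsub>G\<^esub> g \<otimes>\<^bsub>G\<^esub> x \<otimes>\<^bsub>G\<^esub> g)"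

definition inner_auto :: "('a, 'c) monoid_scheme \<Rightarrow> ('a \<Rightarrow> 'a) \<Rightarrow> bool"
  where "inner_auto G \<sigma> \<longleftrightarrow> (\<exists>g\<in>carrier G. \<sigma> = conj_map G g)"

definition coleman_auto :: "('a, 'c) monoid_scheme \<Rightarrow> ('a \<Rightarrow> 'a) \<Rightarrow> bool"
  where "coleman_auto G \<sigma> \<longleftrightarrow> \<sigma> \<in> auto G \<and>
    (\<forall>l Q. prime l \<and> l dvd order G \<and> sylow_subgroup l Q G \<longrightarrow>
      (\<exists>g\<in>carrier G. restrict \<sigma> Q = restrict (conj_map G g) Q))"

text \<open>The external semidirect product for a left action \<open>\<phi>\<close> of \<open>H\<close> on \<open>P\<close> by automorphisms.
  Multiplication in \<^const>\<open>AutoGroup\<close> is composition \<open>f \<circ> g\<close>, so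
  \<open>\<phi> \<in> hom H (AutoGroup P)\<close> says precisely that \<open>\<phi>\<close> is a left action.\<close>

definition semidirect ::
  "('a, 'c) monoid_scheme \<Rightarrow> ('b \<Rightarrow> 'a \<Rightarrow> 'a) \<Rightarrow> ('b, 'd) monoid_scheme \<Rightarrow> ('a \<times> 'b) monoid"
  where "semidirect P \<phi> H =
    \<lparr>carrier = carrier P \<times> carrier H,
     monoid.mult = (\<lambda>(a, h) (b, k). (a \<otimes>\<^bsub>P\<^esub> \<phi> h b, h \<otimes>\<^bsub>H\<^esub> k)),
     one = (\<one>\<^bsub>P\<^esub>, \<one>\<^bsub>H\<^esub>)\<rparr>"

text \<open>The copy of \<open>P\<close> inside the semidirect product.\<close>

definition semidirect_base :: "('a, 'c) monoid_scheme \<Rightarrow> ('b, 'd) monoid_scheme \<Rightarrow> ('a \<times> 'b) set"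
  where "semidirect_base P H = carrier P \<times> {\<one>\<^bsub>H\<^esub>}"

lemma group_semidirect:
  assumes "group P" "group H" and \<phi>: "\<phi> \<in> hom H (AutoGroup P)"
  shows "group (semidirect P \<phi> H)"
proof -
  interpret P: group P by fact
  interpret H: group H by fact
  have \<phi>_hom: "group_hom H (AutoGroup P) \<phi>"
    using \<phi> P.AutoGroup H.is_group by (simp add: group_hom_def group_hom_axioms_def)
  have aut: "\<phi> h \<in> auto P" if "h \<in> carrier H" for h
    using group_hom.hom_closed[OF \<phi>_hom that] by (simp add: AutoGroup_def)
  have closed: "\<phi> h a \<in> carrier P" if "h \<in> carrier H" "a \<in> carrier P" for h a
    using aut[OF that(1)] that(2) by (auto simp: auto_def hom_def)
  have mult: "\<phi> h (a \<otimes>\<^bsub>P\<^esub> b) = \<phi> h a \<otimes>\<^bsub>P\<^esub> \<phi> h b"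
    if "h \<in> carrier H" "a \<in> carrier P" "b \<in> carrier P" for h a b
    using aut[OF that(1)] that(2,3) by (auto simp: auto_def hom_def)
  have act: "\<phi> (h \<otimes>\<^bsub>H\<^esub> k) a = \<phi> h (\<phi> k a)"
    if "h \<in> carrier H" "k \<in> carrier H" "a \<in> carrier P" for h k a
    using group_hom.hom_mult[OF \<phi>_hom that(1,2)] aut[OF that(1)] aut[OF that(2)] that(3)
    by (simp add: AutoGroup_def BijGroup_def auto_def compose_def)
  have one: "\<phi> \<one>\<^bsub>H\<^esub> a = a" if "a \<in> carrier P" for a
    using group_hom.hom_one[OF \<phi>_hom] that by (simp add: AutoGroup_def BijGroup_def)
  show ?thesis
  proof (rule groupI)
    fix x assume "x \<in> carrier (semidirect P \<phi> H)"
    then obtain a h where x: "x = (a, h)" "a \<in> carrier P" "h \<in> carrier H"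
      by (auto simp: semidirect_def)
    let ?y = "(\<phi> (inv\<^bsub>H\<^esub> h) (inv\<^bsub>P\<^esub> a), inv\<^bsub>H\<^esub> h)"
    have "?y \<in> carrier (semidirect P \<phi> H)"
      using x closed by (simp add: semidirect_def)
    moreover have "?y \<otimes>\<^bsub>semidirect P \<phi> H\<^esub> x = \<one>\<^bsub>semidirect P \<phi> H\<^esub>"
    proof -
      have "\<phi> (inv\<^bsub>H\<^esub> h) (inv\<^bsub>P\<^esub> a) \<otimes>\<^bsub>P\<^esub> \<phi> (inv\<^bsub>H\<^esub> h) a = \<phi> (inv\<^bsub>H\<^esub> h) \<one>\<^bsub>P\<^esub>"
        using x mult[of "inv\<^bsub>H\<^esub> h" "inv\<^bsub>P\<^esub> a" a] by simp
      also have "\<dots> = \<one>\<^bsub>P\<^esub>"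
        using mult[of "inv\<^bsub>H\<^esub> h" "\<one>\<^bsub>P\<^esub>" "\<one>\<^bsub>P\<^esub>"] closed x
        by (metis H.inv_closed P.l_one P.one_closed P.r_cancel_one)
      finally show ?thesis using x by (simp add: semidirect_def)
    qed
    ultimately show "\<exists>y\<in>carrier (semidirect P \<phi> H).
        y \<otimes>\<^bsub>semidirect P \<phi> H\<^esub> x = \<one>\<^bsub>semidirect P \<phi> H\<^esub>" by blast
  qed (auto simp: semidirect_def closed mult act one P.m_assoc H.m_assoc)
qed

end

theory Submission
  imports Defs "HOL-Algebra.Multiplicative_Group"
begin

text \<open>
  Let \<open>S\<close> be a Sylow \<open>p\<close>-subgroup of \<open>G\<close> containing \<open>P\<close>, and \<open>\<sigma>\<close> a Coleman automorphism. On \<open>S\<close>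
  it agrees with conjugation by some \<open>g\<close>; undoing this conjugation gives an automorphism \<open>\<tau>\<close> that
  differs from \<open>\<sigma>\<close> by an inner one and fixes \<open>S\<close> pointwise. As \<open>\<tau>\<close> fixes the normal subgroup \<open>P\<close>
  pointwise, \<open>x\<close> and \<open>\<tau> x\<close> act on \<open>P\<close> in the same way, so the displacement \<open>z x = x\<^sup>-\<^sup>1 \<tau>(x)\<close>
  centralizes \<open>P\<close> (\<open>displacement_centralizes\<close>). The hypothesis says that the centralizer
  of \<open>P\<close> lies in \<open>P\<close>; hence it is an abelian \<open>p\<close>-group \<open>A\<close>, the centre of \<open>P\<close>.

  The displacement is a \<open>1\<close>-cocycle of \<open>G\<close> with values in \<open>A\<close>, and it vanishes on \<open>S\<close>. Restriction
  from \<open>H\<^sup>1(G, A)\<close> to \<open>H\<^sup>1(S, A)\<close> is injective because the index of \<open>S\<close> is prime to the order of \<open>A\<close>;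
  the classical proof, averaging over the cosets of \<open>S\<close>, is \<open>cocycle_eq_coboundary\<close>. So \<open>z\<close> is a
  coboundary, which means exactly that \<open>\<tau>\<close> is conjugation by an element of \<open>A\<close>.

  The semidirect decomposition exhibits \<open>S\<close>: if \<open>Q\<close> is a Sylow \<open>p\<close>-subgroup of \<open>H\<close>,
  then \<open>P \<times> Q\<close> is one of \<open>G\<close>, and it contains \<open>P\<close>.
\<close>

section \<open>Cocycles that vanish on a subgroup of coprime index\<close>

lemma (in group) mult_inv_cancel:
  assumes "x \<in> carrier G" "y \<in> carrier G"
  shows "x \<otimes> (inv x \<otimes> y) = y" and "inv x \<otimes> (x \<otimes> y) = y"
  using assms by (simp_all add: m_assoc[symmetric])

lemma hom_finprod:
  assumes "comm_group C" "comm_group D" and h: "h \<in> hom C D" and f: "f \<in> I \<rightarrow> carrier C"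
  shows "h (finprod C f I) = finprod D (\<lambda>i. h (f i)) I"
proof -
  interpret C: comm_group C by fact
  interpret D: comm_group D by fact
  interpret h: group_hom C D h using h by unfold_locales
  show ?thesis using f
  proof (induction I rule: infinite_finite_induct)
    case (insert i I)
    then have "f i \<in> carrier C" "f \<in> I \<rightarrow> carrier C" by auto
    moreover from this have "(\<lambda>j. h (f j)) \<in> I \<rightarrow> carrier D"
      by (auto intro: h.hom_closed dest: funcset_mem)
    ultimately show ?case using insert by simp
  qed auto
qed

text \<open>
  Since \<open>z\<close> vanishes on \<open>S\<close>, it is constant on each coset \<open>S x\<close>; let \<open>a\<close> be the product of these
  constants. Multiplying by \<open>y\<close> permutes the cosets, so the cocycle identity gives
  \<open>a = y\<^sup>-\<^sup>1 a y z(y)\<^sup>m\<close> with \<open>m\<close> the index of \<open>S\<close>. As \<open>m\<close> is invertible modulo the order of \<open>A\<close>,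
  the exponent \<open>m\<close> can be removed by replacing \<open>a\<close> with a suitable power \<open>b\<close>.
\<close>
lemma (in group) cocycle_eq_coboundary:
  assumes A: "A \<lhd> G" and comm: "comm_group (G\<lparr>carrier := A\<rparr>)"
    and S: "subgroup S G" and fin: "finite (carrier G)"
    and cop: "coprime (card (rcosets S)) (card A)"
    and zA: "\<And>x. x \<in> carrier G \<Longrightarrow> z x \<in> A"
    and cocycle: "\<And>x y. x \<in> carrier G \<Longrightarrow> y \<in> carrier G \<Longrightarrow>
      z (x \<otimes> y) = inv y \<otimes> z x \<otimes> y \<otimes> z y"
    and triv: "\<And>s. s \<in> S \<Longrightarrow> z s = \<one>"
  shows "\<exists>b\<in>A. \<forall>y\<in>carrier G. z y = inv y \<otimes> inv b \<otimes> y \<otimes> b"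
proof -
  define C where "C = G\<lparr>carrier := A\<rparr>"
  interpret C: comm_group C using comm by (simp add: C_def)
  interpret A: normal A G by fact
  interpret S: subgroup S G by fact
  have carC: "carrier C = A" and multC: "u \<otimes>\<^bsub>C\<^esub> v = u \<otimes> v" for u v
    by (simp_all add: C_def)
  have AG: "u \<in> carrier G" if "u \<in> A" for u using that by (rule A.mem_carrier)
  have finR: "finite (rcosets S)"
    using fin rcosets_subset_PowG[OF S] finite_subset by blast
  have cA: "inv y \<otimes> u \<otimes> y \<in> A" if "y \<in> carrier G" "u \<in> A" for y u
    using that by (rule A.inv_op_closed1)
  \<comment> \<open>The value of \<open>z\<close> on a whole coset; the chosen representative is irrelevant.\<close>
  define f where "f K = z (SOME x. x \<in> K)" for K
  have f_coset: "f (S #> x) = z x" if x: "x \<in> carrier G" for x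
  proof -
    have "x \<in> S #> x" using x S by (rule rcos_self)
    then have "(SOME t. t \<in> S #> x) \<in> S #> x" by (rule someI)
    then obtain s where s: "s \<in> S" "(SOME t. t \<in> S #> x) = s \<otimes> x"
      by (auto simp: r_coset_def)
    have "z (s \<otimes> x) = z x"
      using cocycle[of s x] s(1) x triv[of s] AG[OF zA[OF x]] by simp
    then show ?thesis by (simp add: f_def s(2))
  qed
  define a where "a = finprod C f (rcosets S)"
  define m where "m = card (rcosets S)"
  have fA: "f \<in> rcosets S \<rightarrow> carrier C"
    using f_coset zA by (auto simp: RCOSETS_def carC)
  have aA: "a \<in> A" unfolding a_def using C.finprod_closed[OF fA] carC by simp
  have a_eq: "a = inv y \<otimes> a \<otimes> y \<otimes> z y [^]\<^bsub>C\<^esub> m" if y: "y \<in> carrier G" for y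
  proof -
    define t where "t K = K #> y" for K
    define c where "c u = inv y \<otimes> u \<otimes> y" for u
    have t_coset: "t (S #> x) = S #> (x \<otimes> y)" if "x \<in> carrier G" for x
      using that y S.subset by (simp add: t_def coset_mult_assoc)
    have inj: "inj_on t (rcosets S)"
    proof (rule inj_onI)
      fix K L assume KL: "K \<in> rcosets S" "L \<in> rcosets S" "t K = t L"
      then have "K \<subseteq> carrier G" "L \<subseteq> carrier G"
        using rcosets_subset_PowG[OF S] by auto
      then show "K = L"
        using KL(3) y unfolding t_def
        by (metis coset_mult_assoc coset_mult_one inv_closed r_inv)
    qed
    have "t ` (rcosets S) \<subseteq> rcosets S"
      using t_coset y by (force simp: RCOSETS_def)
    then have image: "t ` (rcosets S) = rcosets S"
      using endo_inj_surj[OF finR _ inj] by blast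
    have c_hom: "c \<in> hom C C"
    proof (rule homI)
      fix u v assume "u \<in> carrier C" "v \<in> carrier C"
      then show "c (u \<otimes>\<^bsub>C\<^esub> v) = c u \<otimes>\<^bsub>C\<^esub> c v"
        using y AG by (simp add: carC multC c_def m_assoc mult_inv_cancel)
    qed (use y cA in \<open>simp add: carC c_def\<close>)
    have cf: "(\<lambda>K. c (f K)) \<in> rcosets S \<rightarrow> carrier C"
      using fA c_hom by (auto simp: hom_def)
    have zy: "z y \<in> carrier C" using zA[OF y] carC by simp
    have "a = finprod C (\<lambda>K. f (t K)) (rcosets S)"
      unfolding a_def using C.finprod_reindex[of f t "rcosets S"] inj image fA by simp
    also have "\<dots> = finprod C (\<lambda>K. c (f K) \<otimes>\<^bsub>C\<^esub> z y) (rcosets S)"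
    proof (rule C.finprod_cong')
      show "(\<lambda>K. c (f K) \<otimes>\<^bsub>C\<^esub> z y) \<in> rcosets S \<rightarrow> carrier C"
        using cf zy by auto
      fix K assume "K \<in> rcosets S"
      then obtain x where "x \<in> carrier G" "K = S #> x" by (auto simp: RCOSETS_def)
      then show "f (t K) = c (f K) \<otimes>\<^bsub>C\<^esub> z y"
        using y by (simp add: t_coset f_coset cocycle c_def multC)
    qed simp
    also have "\<dots> = finprod C (\<lambda>K. c (f K)) (rcosets S) \<otimes>\<^bsub>C\<^esub> z y [^]\<^bsub>C\<^esub> m"
      using cf zy by (simp add: C.finprod_multf C.finprod_const m_def)
    also have "finprod C (\<lambda>K. c (f K)) (rcosets S) = c a"
      unfolding a_def using hom_finprod[OF C.comm_group_axioms C.comm_group_axioms c_hom fA] by simp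
    finally show ?thesis by (simp add: c_def multC)
  qed
  have "m \<noteq> 0" unfolding m_def
    using finR S.subgroup_in_rcosets[OF is_group] by (auto simp: card_eq_0_iff)
  then obtain k l where kl: "m * k = card A * l + 1"
    using bezout_nat[of m "card A"] cop by (auto simp: m_def)
  define b where "b = a [^]\<^bsub>C\<^esub> k"
  have bA: "b \<in> A" using C.nat_pow_closed[of a k] aA by (simp add: b_def carC)
  have "z y = inv y \<otimes> inv b \<otimes> y \<otimes> b" if y: "y \<in> carrier G" for y
  proof -
    define c where "c u = inv y \<otimes> u \<otimes> y" for u
    have zy: "z y \<in> carrier C" using zA[OF y] carC by simp
    have ca: "c a \<in> carrier C" using cA[OF y aA] by (simp add: c_def carC)
    have pow_c: "c a [^]\<^bsub>C\<^esub> n = c (a [^]\<^bsub>C\<^esub> n)" for n :: nat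
    proof (induction n)
      case 0 show ?case using y by (simp add: c_def C_def)
    next
      case (Suc n)
      have "a [^]\<^bsub>C\<^esub> n \<in> A" using C.nat_pow_closed[of a n] aA carC by simp
      then show ?case using Suc y aA AG
        by (simp add: multC c_def m_assoc mult_inv_cancel)
    qed
    have "z y [^]\<^bsub>C\<^esub> card A = \<one>\<^bsub>C\<^esub>"
      using C.pow_order_eq_1[OF zy] by (simp add: order_def carC)
    then have "z y [^]\<^bsub>C\<^esub> (card A * l + 1) = z y"
      using zy by (simp add: C.nat_pow_mult[symmetric] C.nat_pow_pow[symmetric])
    then have z_pow: "(z y [^]\<^bsub>C\<^esub> m) [^]\<^bsub>C\<^esub> k = z y"
      using zy kl by (simp add: C.nat_pow_pow)
    have "b = (c a \<otimes>\<^bsub>C\<^esub> z y [^]\<^bsub>C\<^esub> m) [^]\<^bsub>C\<^esub> k"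
      using a_eq[OF y] by (simp add: b_def c_def multC)
    also have "\<dots> = c b \<otimes>\<^bsub>C\<^esub> z y"
      using ca zy by (simp add: C.pow_mult_distrib C.m_comm pow_c z_pow b_def)
    finally have "b = inv y \<otimes> b \<otimes> y \<otimes> z y" by (simp add: c_def multC)
    then have "inv (inv y \<otimes> b \<otimes> y) \<otimes> b = z y"
      using y AG[OF bA] AG[OF zA[OF y]] by (metis inv_solve_left m_closed inv_closed)
    then show ?thesis
      using y AG[OF bA] by (simp add: inv_mult_group m_assoc)
  qed
  then show ?thesis using bA by blast
qed

section \<open>Endomorphisms fixing a normal subgroup that contains its centralizer\<close>

text \<open>
  For \<open>u \<in> P\<close> the conjugate \<open>x u x\<^sup>-\<^sup>1\<close> is again in \<open>P\<close>, hence equal to its image \<open>\<tau>(x) u \<tau>(x)\<^sup>-\<^sup>1\<close>.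
\<close>
lemma (in group) displacement_centralizes:
  assumes P: "P \<lhd> G" and \<tau>: "\<tau> \<in> hom G G" and fix_P: "\<And>u. u \<in> P \<Longrightarrow> \<tau> u = u"
    and x: "x \<in> carrier G"
  shows "inv x \<otimes> \<tau> x \<in> centralizer G P"
proof -
  interpret P: normal P G by fact
  have \<tau>x: "\<tau> x \<in> carrier G" using \<tau> x by (auto simp: hom_def)
  have "inv x \<otimes> \<tau> x \<otimes> u = u \<otimes> (inv x \<otimes> \<tau> x)" if u: "u \<in> P" for u
  proof -
    have uG: "u \<in> carrier G" using u by (rule P.mem_carrier)
    define v where "v = x \<otimes> u \<otimes> inv x"
    have v: "v \<in> P" unfolding v_def using x u by (rule P.inv_op_closed2)
    have vG: "v \<in> carrier G" using v by (rule P.mem_carrier)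
    have vx: "v \<otimes> x = x \<otimes> u" using x uG by (simp add: v_def m_assoc)
    have "\<tau> x \<otimes> u = \<tau> (x \<otimes> u)" using \<tau> x uG fix_P[OF u] by (simp add: hom_mult)
    also have "\<dots> = v \<otimes> \<tau> x" using \<tau> x vG fix_P[OF v] by (simp add: vx[symmetric] hom_mult)
    finally have "inv x \<otimes> \<tau> x \<otimes> u = inv x \<otimes> v \<otimes> \<tau> x"
      using x \<tau>x uG vG by (simp add: m_assoc)
    also have "inv x \<otimes> v = u \<otimes> inv x" using x uG by (simp add: v_def m_assoc mult_inv_cancel)
    finally show ?thesis using x \<tau>x uG by (simp add: m_assoc)
  qed
  then show ?thesis using x \<tau>x by (simp add: centralizer_def)
qed

lemma (in group) centralizer_normal:
  assumes P: "P \<lhd> G"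
  shows "centralizer G P \<lhd> G"
proof -
  interpret P: normal P G by fact
  have sub: "subgroup (centralizer G P) G"
  proof (rule subgroupI)
    fix a assume a: "a \<in> centralizer G P"
    then have aG: "a \<in> carrier G" by (simp add: centralizer_def)
    have "inv a \<otimes> u = u \<otimes> inv a" if "u \<in> P" for u
    proof -
      have uG: "u \<in> carrier G" using that by (rule P.mem_carrier)
      have "inv a \<otimes> u = inv a \<otimes> (u \<otimes> a) \<otimes> inv a" using aG uG by (simp add: m_assoc)
      also have "u \<otimes> a = a \<otimes> u" using a that by (simp add: centralizer_def)
      finally show ?thesis using aG uG by (simp add: mult_inv_cancel)
    qed
    then show "inv a \<in> centralizer G P" using a by (simp add: centralizer_def)
  next
    fix a b assume a: "a \<in> centralizer G P" and b: "b \<in> centralizer G P"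
    then have ab: "a \<in> carrier G" "b \<in> carrier G" by (simp_all add: centralizer_def)
    have "a \<otimes> b \<otimes> u = u \<otimes> (a \<otimes> b)" if "u \<in> P" for u
    proof -
      have uG: "u \<in> carrier G" using that by (rule P.mem_carrier)
      have "b \<otimes> u = u \<otimes> b" using b that by (simp add: centralizer_def)
      then have "a \<otimes> b \<otimes> u = (a \<otimes> u) \<otimes> b" using ab uG by (simp add: m_assoc)
      also have "a \<otimes> u = u \<otimes> a" using a that by (simp add: centralizer_def)
      finally show ?thesis using ab uG by (simp add: m_assoc)
    qed
    then show "a \<otimes> b \<in> centralizer G P" using ab by (simp add: centralizer_def)
  next
    have "\<one> \<in> centralizer G P" using P.mem_carrier by (simp add: centralizer_def)
    then show "centralizer G P \<noteq> {}" by blast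
  next
    show "centralizer G P \<subseteq> carrier G" unfolding centralizer_def by blast
  qed
  have "x \<otimes> a \<otimes> inv x \<in> centralizer G P" if x: "x \<in> carrier G" and a: "a \<in> centralizer G P" for x a
  proof -
    have aG: "a \<in> carrier G" using a by (simp add: centralizer_def)
    have "x \<otimes> a \<otimes> inv x \<otimes> u = u \<otimes> (x \<otimes> a \<otimes> inv x)" if u: "u \<in> P" for u
    proof -
      have uG: "u \<in> carrier G" using u by (rule P.mem_carrier)
      define v where "v = inv x \<otimes> u \<otimes> x"
      have v: "v \<in> P" unfolding v_def using x u by (rule P.inv_op_closed1)
      have vG: "v \<in> carrier G" using v by (rule P.mem_carrier)
      have u_eq: "u = x \<otimes> v \<otimes> inv x" using x uG by (simp add: v_def m_assoc mult_inv_cancel)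
      have av: "a \<otimes> v = v \<otimes> a" using a v by (simp add: centralizer_def)
      have "x \<otimes> a \<otimes> inv x \<otimes> u = x \<otimes> (a \<otimes> v) \<otimes> inv x"
        using x aG vG by (simp add: u_eq m_assoc mult_inv_cancel)
      also have "\<dots> = u \<otimes> (x \<otimes> a \<otimes> inv x)"
        unfolding av using x aG vG by (simp add: u_eq m_assoc mult_inv_cancel)
      finally show ?thesis .
    qed
    then show ?thesis using x aG by (simp add: centralizer_def)
  qed
  then show ?thesis using sub by (simp add: normal_inv_iff)
qed

text \<open>
  The displacement \<open>x\<^sup>-\<^sup>1 \<tau>(x)\<close> is a cocycle with values in the centralizer of \<open>P\<close>, which is abelian
  because it lies in \<open>P\<close>. Writing it as a coboundary \<open>x\<^sup>-\<^sup>1 b\<^sup>-\<^sup>1 x b\<close> says that \<open>\<tau>\<close> is conjugation by \<open>b\<close>.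
\<close>
lemma (in group) inner_if_fixes_large_subgroup:
  assumes fin: "finite (carrier G)" and P: "P \<lhd> G" and self: "centralizer G P \<subseteq> P"
    and S: "subgroup S G" and PS: "P \<subseteq> S" and cop: "coprime (card (rcosets S)) (card P)"
    and \<tau>: "\<tau> \<in> hom G G" and fix_S: "\<And>s. s \<in> S \<Longrightarrow> \<tau> s = s"
  shows "\<exists>b\<in>carrier G. \<forall>x\<in>carrier G. \<tau> x = inv b \<otimes> x \<otimes> b"
proof -
  interpret P: normal P G by fact
  define A where "A = centralizer G P"
  have A: "A \<lhd> G" unfolding A_def using P by (rule centralizer_normal)
  interpret A: normal A G by fact
  have AP: "A \<subseteq> P" using self by (simp add: A_def)
  have comm: "comm_group (G\<lparr>carrier := A\<rparr>)"
  proof (rule group.group_comm_groupI)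
    show "group (G\<lparr>carrier := A\<rparr>)" using A.subgroup_axioms by (rule subgroup_imp_group)
    fix u v assume "u \<in> carrier (G\<lparr>carrier := A\<rparr>)" "v \<in> carrier (G\<lparr>carrier := A\<rparr>)"
    then have "u \<in> centralizer G P" "v \<in> P" using AP by (auto simp: A_def)
    then show "u \<otimes>\<^bsub>G\<lparr>carrier := A\<rparr>\<^esub> v = v \<otimes>\<^bsub>G\<lparr>carrier := A\<rparr>\<^esub> u"
      by (simp add: centralizer_def)
  qed
  have "subgroup A (G\<lparr>carrier := P\<rparr>)"
    using A.subgroup_axioms P.subgroup_axioms AP by (rule subgroup_incl)
  then have "card (rcosets\<^bsub>G\<lparr>carrier := P\<rparr>\<^esub> A) * card A = card P"
    using group.lagrange[OF subgroup_imp_group[OF P.subgroup_axioms], of A]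
    by (simp add: order_def)
  then have "card A dvd card P" by (metis dvd_triv_right)
  then have copA: "coprime (card (rcosets S)) (card A)"
    using cop coprime_divisors dvd_refl by blast
  define z where "z x = inv x \<otimes> \<tau> x" for x
  have \<tau>G: "\<tau> x \<in> carrier G" if "x \<in> carrier G" for x using \<tau> that by (auto simp: hom_def)
  have "\<exists>b\<in>A. \<forall>y\<in>carrier G. z y = inv y \<otimes> inv b \<otimes> y \<otimes> b"
  proof (rule cocycle_eq_coboundary[OF A comm S fin copA])
    show "z x \<in> A" if "x \<in> carrier G" for x
      unfolding z_def A_def using displacement_centralizes[OF P \<tau> _ that] fix_S PS by blast
    show "z (x \<otimes> y) = inv y \<otimes> z x \<otimes> y \<otimes> z y" if "x \<in> carrier G" "y \<in> carrier G" for x y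
      using that \<tau>G \<tau> by (simp add: z_def hom_mult inv_mult_group m_assoc mult_inv_cancel)
    show "z s = \<one>" if "s \<in> S" for s
      using that fix_S[OF that] subgroup.mem_carrier[OF S that] by (simp add: z_def)
  qed
  then obtain b where b: "b \<in> A" "\<And>y. y \<in> carrier G \<Longrightarrow> z y = inv y \<otimes> inv b \<otimes> y \<otimes> b" by blast
  have bG: "b \<in> carrier G" using b(1) by (rule A.mem_carrier)
  have "\<tau> x = inv b \<otimes> x \<otimes> b" if x: "x \<in> carrier G" for x
  proof -
    have "\<tau> x = x \<otimes> z x" using x \<tau>G[OF x] by (simp add: z_def m_assoc[symmetric])
    also have "\<dots> = inv b \<otimes> x \<otimes> b"
      using x bG by (simp add: b(2) m_assoc[symmetric])
    finally show ?thesis .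
  qed
  then show ?thesis using bG by blast
qed

text \<open>Composing with conjugation by the inverse of \<open>g\<close> reduces to the case where \<open>S\<close> is fixed
  pointwise.\<close>
lemma (in group) inner_if_conj_on_large_subgroup:
  assumes fin: "finite (carrier G)" and P: "P \<lhd> G" and self: "centralizer G P \<subseteq> P"
    and S: "subgroup S G" and PS: "P \<subseteq> S" and cop: "coprime (card (rcosets S)) (card P)"
    and \<sigma>: "\<sigma> \<in> auto G" and g: "g \<in> carrier G"
    and \<sigma>_S: "restrict \<sigma> S = restrict (conj_map G g) S"
  shows "inner_auto G \<sigma>"
proof -
  have \<sigma>_hom: "\<sigma> \<in> hom G G" and \<sigma>_ext: "\<sigma> \<in> extensional (carrier G)"
    using \<sigma> by (auto simp: auto_def Bij_def)
  have \<sigma>G: "\<sigma> x \<in> carrier G" if "x \<in> carrier G" for x using \<sigma>_hom that by (auto simp: hom_def)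
  define \<tau> where "\<tau> x = g \<otimes> \<sigma> x \<otimes> inv g" for x
  have \<tau>: "\<tau> \<in> hom G G"
  proof (rule homI)
    fix x y assume "x \<in> carrier G" "y \<in> carrier G"
    then show "\<tau> (x \<otimes> y) = \<tau> x \<otimes> \<tau> y"
      using \<sigma>G g by (simp add: \<tau>_def hom_mult[OF \<sigma>_hom] m_assoc mult_inv_cancel)
  qed (use \<sigma>G g in \<open>simp add: \<tau>_def\<close>)
  have "\<tau> s = s" if s: "s \<in> S" for s
  proof -
    have sG: "s \<in> carrier G" using S s by (rule subgroup.mem_carrier)
    have "\<sigma> s = inv g \<otimes> s \<otimes> g"
      using fun_cong[OF \<sigma>_S, of s] s sG by (simp add: conj_map_def)
    then show ?thesis using g sG by (simp add: \<tau>_def m_assoc mult_inv_cancel)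
  qed
  then obtain b where b: "b \<in> carrier G" "\<And>x. x \<in> carrier G \<Longrightarrow> \<tau> x = inv b \<otimes> x \<otimes> b"
    using inner_if_fixes_large_subgroup[OF fin P self S PS cop \<tau>] by blast
  have "\<sigma> x = conj_map G (b \<otimes> g) x" for x
  proof (cases "x \<in> carrier G")
    case True
    then have "\<sigma> x = inv g \<otimes> \<tau> x \<otimes> g"
      using g \<sigma>G[OF True] by (simp add: \<tau>_def m_assoc mult_inv_cancel)
    then show ?thesis using True g b by (simp add: conj_map_def inv_mult_group m_assoc)
  next
    case False
    then show ?thesis using \<sigma>_ext by (simp add: conj_map_def extensional_def)
  qed
  then have "\<sigma> = conj_map G (b \<otimes> g)" by (rule ext)
  then show ?thesis unfolding inner_auto_def using m_closed[OF b(1) g] by blast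
qed

section \<open>Subgroups of the semidirect product\<close>

lemma semidirect_snd_hom:
  assumes "group P" "group H" and \<phi>: "\<phi> \<in> hom H (AutoGroup P)"
  shows "group_hom (semidirect P \<phi> H) H snd"
  using group_semidirect[OF assms] assms(2)
  by (auto simp: group_hom_def group_hom_axioms_def hom_def semidirect_def)

lemma semidirect_base_normal:
  assumes "group P" "group H" and \<phi>: "\<phi> \<in> hom H (AutoGroup P)"
  shows "semidirect_base P H \<lhd> semidirect P \<phi> H"
proof -
  have "kernel (semidirect P \<phi> H) H snd = semidirect_base P H"
    using group.is_monoid[OF assms(2)]
    by (auto simp: kernel_def semidirect_def semidirect_base_def monoid.one_closed)
  then show ?thesis
    using group_hom.normal_kernel[OF semidirect_snd_hom[OF assms]] by simp
qed

lemma (in group_hom) subgroup_preimage: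
  assumes Q: "subgroup Q H"
  shows "subgroup {x \<in> carrier G. h x \<in> Q} G"
proof -
  interpret Q: subgroup Q H by fact
  show ?thesis by (rule G.subgroupI) (auto intro: G.one_closed)
qed

lemma semidirect_subgroup:
  assumes "group P" "group H" and \<phi>: "\<phi> \<in> hom H (AutoGroup P)" and Q: "subgroup Q H"
  shows "subgroup (carrier P \<times> Q) (semidirect P \<phi> H)"
proof -
  have "{x \<in> carrier (semidirect P \<phi> H). snd x \<in> Q} = carrier P \<times> Q"
    using subgroup.subset[OF Q] by (auto simp: semidirect_def)
  then show ?thesis
    using group_hom.subgroup_preimage[OF semidirect_snd_hom[OF assms(1-3)] Q] by simp
qed

section \<open>Coleman automorphisms\<close>

theorem corollary2p3:
  fixes p :: nat
    and P :: "('a, 'c) monoid_scheme"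
    and H :: "('b, 'd) monoid_scheme"
    and \<phi> :: "'b \<Rightarrow> 'a \<Rightarrow> 'a"
    and G :: "('a \<times> 'b) monoid"
  assumes "prime p"
    and "finite_p_group p P"
    and "group H" and "finite (carrier H)"
    and "\<phi> \<in> hom H (AutoGroup P)"
    and "G = semidirect P \<phi> H"
    and "centralizer G (semidirect_base P H) \<subseteq> semidirect_base P H"
  shows "\<forall>\<sigma>. coleman_auto G \<sigma> \<longrightarrow> inner_auto G \<sigma>"
proof (intro allI impI)
  fix \<sigma> assume \<sigma>: "coleman_auto G \<sigma>"
  have "group P" and finP: "finite (carrier P)" and "\<exists>n. order P = p ^ n"
    using assms(2) by (auto simp: finite_p_group_def)
  then obtain n where n: "order P = p ^ n" by blast
  interpret P: group P by fact
  interpret H: group H by fact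
  interpret G: group G
    unfolding assms(6) using \<open>group P\<close> assms(3,5) by (rule group_semidirect)
  define N where "N = semidirect_base P H"
  have N: "N \<lhd> G"
    unfolding N_def assms(6) using \<open>group P\<close> assms(3,5) by (rule semidirect_base_normal)
  have cardN: "card N = p ^ n"
    using n by (simp add: N_def semidirect_base_def card_cartesian_product order_def)
  have finG: "finite (carrier G)"
    using finP assms(4) by (simp add: assms(6) semidirect_def)
  have orderG: "order G = p ^ n * order H"
    using n by (simp add: assms(6) semidirect_def order_def card_cartesian_product)
  have H0: "order H \<noteq> 0" using assms(4) by (simp add: H.order_gt_0_iff_finite)
  have not_unit: "\<not> p dvd 1" using assms(1) by auto
  define k where "k = multiplicity p (order H)"
  obtain r where r: "order H = p ^ k * r" "\<not> p dvd r"
    unfolding k_def using multiplicity_decompose'[OF H0 not_unit] by blast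
  obtain Q where Q: "subgroup Q H" "card Q = p ^ k"
    using sylow_thm[OF assms(1,3) r(1) assms(4)] by blast
  define S where "S = carrier P \<times> Q"
  have S: "subgroup S G"
    unfolding S_def assms(6) using \<open>group P\<close> assms(3,5) Q(1) by (rule semidirect_subgroup)
  have cardS: "card S = p ^ (n + k)"
    using n Q(2) by (simp add: S_def card_cartesian_product order_def power_add)
  have orderG': "order G = p ^ (n + k) * r" using orderG r(1) by (simp add: power_add)
  have "p > 0" using assms(1) by (rule prime_gt_0_nat)
  have mult_p: "multiplicity p (order G) = n + k"
    using orderG' r(2) \<open>p > 0\<close> by (intro multiplicity_decomposeI) auto
  have NS: "N \<subseteq> S"
    using subgroup.one_closed[OF Q(1)] by (auto simp: N_def S_def semidirect_base_def)
  have self: "centralizer G N \<subseteq> N" using assms(7) by (simp add: N_def)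
  have "card (rcosets\<^bsub>G\<^esub> S) * p ^ (n + k) = r * p ^ (n + k)"
    using G.lagrange[OF S] cardS orderG' by (simp add: mult.commute)
  then have "card (rcosets\<^bsub>G\<^esub> S) = r" using \<open>p > 0\<close> by simp
  then have cop: "coprime (card (rcosets\<^bsub>G\<^esub> S)) (card N)"
    using prime_imp_coprime[OF assms(1) r(2)] by (simp add: cardN coprime_commute)
  obtain g where g: "g \<in> carrier G" "restrict \<sigma> S = restrict (conj_map G g) S"
  proof (cases "p dvd order G")
    case True
    moreover have "sylow_subgroup p S G"
      using S cardS mult_p by (simp add: sylow_subgroup_def)
    ultimately have "\<exists>g\<in>carrier G. restrict \<sigma> S = restrict (conj_map G g) S"
      using \<sigma> assms(1) unfolding coleman_auto_def by blast
    then show thesis using that by blast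
  next
    \<comment> \<open>The Coleman property says nothing about primes not dividing the order of \<open>G\<close>,
      but here \<open>S\<close> is trivial.\<close>
    case False
    then have "n + k = 0" using orderG' by (metis dvd_mult2 dvd_power gr0I)
    then have "card S = 1" using cardS by simp
    then have "S = {\<one>\<^bsub>G\<^esub>}"
      using subgroup.one_closed[OF S] by (metis card_1_singletonE singletonD)
    moreover have "\<sigma> \<one>\<^bsub>G\<^esub> = \<one>\<^bsub>G\<^esub>"
    proof (rule hom_one[OF _ G.is_group G.is_group])
      show "\<sigma> \<in> hom G G" using \<sigma> unfolding coleman_auto_def auto_def by blast
    qed
    ultimately have "restrict \<sigma> S = restrict (conj_map G \<one>\<^bsub>G\<^esub>) S"
      by (simp add: conj_map_def restrict_def fun_eq_iff)
    then show thesis using that[OF G.one_closed] by blast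
  qed
  have "\<sigma> \<in> auto G" using \<sigma> unfolding coleman_auto_def by blast
  then show "inner_auto G \<sigma>"
    using g by (rule G.inner_if_conj_on_large_subgroup[OF finG N self S NS cop])
qed

end
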